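(* Let $\alpha\in(0,1)$ and $c\in(0,1)$. Let $t_c=Q^{-1}(c)$, where $0<t_c<1$ and $Q(t_c)=c$. Assume that $F\ne U$. Define $$t_{c,m}\equiv t_{c,m}(\alpha)=t_c-\frac{z_\alpha}{\sqrt m}\,\frac{\sqrt{K_\Omega(t_c,t_c)}}{1-a-c\,g(t_c)}.$$ Then $$\mathsf P\{\Gamma(t_{c,m})\le c\}=1-\alpha+O(m^{-1/2})\qquad(m\to\infty).$$
   Context: Model: for each $m$, the pairs $(P_i,H_i)$, $i=1,\dots,m$, are i.i.d. with $H_i\sim\text{Bernoulli}(a)$, $0\le a\le1$; conditionally on $H_i=0$, $P_i$ is Uniform$(0,1)$; conditionally on $H_i=1$, $P_i$ has distribution function $F$ on $[0,1]$ with $F(t)\ge t$ for all $t$. The marginal distribution function of $P_i$ is $G(t)=(1-a)t+aF(t)$, and $U(t)=t$. Standing assumption: $G$ is strictly concave with density $g=G'$. $Q(t)=(1-a)t/G(t)$; $z_\alpha$ is the upper $\alpha$-quantile of the standard normal distribution; and $$K_\Omega(s,t)=(1-a)(1-c)\bigl[(1-c)(s\wedge t-(1-a)st)+ac\,(tF(s)+sF(t))\bigr]+ac\bigl[c\,F(s\wedge t)-ac\,F(s)F(t)\bigr].$$ The FDP process is $$\Gamma(t)=\frac{\sum_{i=1}^m \mathbf 1\{P_i\le t\}(1-H_i)}{\sum_{i=1}^m \mathbf 1\{P_i\le t\}+\mathbf 1\{\text{all }P_i>t\}}.$$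
   Formalization: The formal theorem additionally assumes g(t) − g(t_c) = O(t − t_c) as t → t_c (e.g. G twice differentiable at t_c); without it the O(m^{-1/2}) rate can fail, e.g. a = 1/2, g(1/2+h) = 1 − ½ sgn(h)|h|^{1/2}, t_c = 1/2 and α ≠ 1/2. *)

theory Defs
  imports "HOL-Probability.Probability" "HOL-Library.Landau_Symbols"
begin

definition strictly_concave_on :: "real set \<Rightarrow> (real \<Rightarrow> real) \<Rightarrow> bool" where
  "strictly_concave_on S f \<longleftrightarrow> convex S \<and>
     (\<forall>x\<in>S. \<forall>y\<in>S. \<forall>u. x \<noteq> y \<and> 0 < u \<and> u < 1 \<longrightarrow>
        (1 - u) * f x + u * f y < f ((1 - u) * x + u * y))"

definition unit_interval_cdf :: "(real \<Rightarrow> real) \<Rightarrow> bool" where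
  "unit_interval_cdf F \<longleftrightarrow> mono F \<and> (\<forall>t. continuous (at_right t) F) \<and>
     (\<forall>t<0. F t = 0) \<and> (\<forall>t\<ge>1. F t = 1)"

definition marginal_cdf :: "real \<Rightarrow> (real \<Rightarrow> real) \<Rightarrow> real \<Rightarrow> real" where
  "marginal_cdf a F t = (1 - a) * t + a * F t"

(* g may be infinite at 0, so the derivative is only required in the open interval; the integral
   condition says that G is the distribution function with density g (so G 0 = 0). *)
definition has_density_derivative :: "(real \<Rightarrow> real) \<Rightarrow> (real \<Rightarrow> real) \<Rightarrow> bool" where
  "has_density_derivative G g \<longleftrightarrow>
     (\<forall>t\<in>{0<..<1}. (G has_real_derivative g t) (at t)) \<and>
     (\<forall>t\<in>{0..1}. (g has_integral G t) {0..t})"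

definition Q_fun :: "real \<Rightarrow> (real \<Rightarrow> real) \<Rightarrow> real \<Rightarrow> real" where
  "Q_fun a F t = (1 - a) * t / marginal_cdf a F t"

definition upper_normal_quantile :: "real \<Rightarrow> real" where
  "upper_normal_quantile \<alpha> = (THE z. measure std_normal_distribution {z<..} = \<alpha>)"

definition K_Omega :: "real \<Rightarrow> real \<Rightarrow> (real \<Rightarrow> real) \<Rightarrow> real \<Rightarrow> real \<Rightarrow> real" where
  "K_Omega a c F s t =
     (1 - a) * (1 - c) *
       ((1 - c) * (min s t - (1 - a) * s * t) + a * c * (t * F s + s * F t)) +
     a * c * (c * F (min s t) - a * c * F s * F t)"

definition t_cm ::
  "real \<Rightarrow> real \<Rightarrow> (real \<Rightarrow> real) \<Rightarrow> (real \<Rightarrow> real) \<Rightarrow> real \<Rightarrow> real \<Rightarrow> nat \<Rightarrow> real" where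
  "t_cm a c F g tc \<alpha> m =
     tc - upper_normal_quantile \<alpha> / sqrt (real m) *
       (sqrt (K_Omega a c F tc tc) / (1 - a - c * g tc))"

definition FDP ::
  "nat \<Rightarrow> (nat \<Rightarrow> 'a \<Rightarrow> real) \<Rightarrow> (nat \<Rightarrow> 'a \<Rightarrow> bool) \<Rightarrow> 'a \<Rightarrow> real \<Rightarrow> real" where
  "FDP m P H \<omega> t =
     (\<Sum>i=1..m. of_bool (P i \<omega> \<le> t) * (1 - of_bool (H i \<omega>))) /
     ((\<Sum>i=1..m. of_bool (P i \<omega> \<le> t)) + of_bool (\<forall>i\<in>{1..m}. P i \<omega> > t))"

(* H i holds iff H_i = 1.  Conditioning on an event of probability 0 imposes nothing.  The three
   conditions on H i and P i determine the joint law of (P_i, H_i), so the pairs are identically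
   distributed. *)
locale mixture_sample = prob_space M
  for M :: "'a measure" +
  fixes m :: nat and a :: real and F :: "real \<Rightarrow> real"
    and P :: "nat \<Rightarrow> 'a \<Rightarrow> real" and H :: "nat \<Rightarrow> 'a \<Rightarrow> bool"
  assumes indep: "indep_vars (\<lambda>_. borel \<Otimes>\<^sub>M count_space UNIV) (\<lambda>i \<omega>. (P i \<omega>, H i \<omega>)) {1..m}"
    and bernoulli: "\<And>i. i \<in> {1..m} \<Longrightarrow>
      distr M (count_space UNIV) (H i) = measure_pmf (bernoulli_pmf a)"
    and null_uniform: "\<And>i t. i \<in> {1..m} \<Longrightarrow> prob {\<omega> \<in> space M. \<not> H i \<omega>} > 0 \<Longrightarrow> t \<in> {0..1} \<Longrightarrow>
      \<P>(\<omega> in M. P i \<omega> \<le> t \<bar> \<not> H i \<omega>) = t"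
    and alternative_cdf: "\<And>i t. i \<in> {1..m} \<Longrightarrow> prob {\<omega> \<in> space M. H i \<omega>} > 0 \<Longrightarrow>
      \<P>(\<omega> in M. P i \<omega> \<le> t \<bar> H i \<omega>) = F t"

end

theory Submission
  imports Defs
begin

text \<open>
  The event that the false discovery proportion at threshold \<open>t\<close> is at most \<open>c\<close> is linear in the data: it says
  that the sum over \<open>i\<close> of \<open>of_bool (P i \<le> t) * (1 - of_bool (H i) - c)\<close> is nonpositive (\<open>FDP_le_iff\<close>). The
  terms are independent, identically distributed and bounded, with mean \<open>\<mu> t = (1 - a) * t - c * G t\<close> and
  variance \<open>V t = K_Omega a c F t t\<close>. By a Berry--Esseen bound the probability of the event is the
  normal distribution function at \<open>- sqrt m * \<mu> t / sqrt (V t)\<close>, with an error of order \<open>1 / sqrt m\<close> that is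
  uniform for \<open>t\<close> near \<open>tc\<close> (\<open>FDP_normal_approximation\<close>); uniformity matters because the threshold moves
  with \<open>m\<close>.

  The equation \<open>Q_fun a F tc = c\<close> says that \<open>\<mu> tc = 0\<close>. The slope of \<open>\<mu>\<close> at \<open>tc\<close> is \<open>b = 1 - a - c * g tc\<close>,
  which is positive because a strictly concave \<open>G\<close> with \<open>G 0 = 0\<close> lies strictly below its tangent
  (\<open>strictly_concave_tangent\<close>). As \<open>g\<close> is Lipschitz at \<open>tc\<close>, \<open>\<mu> t\<close> differs from \<open>b * (t - tc)\<close> by a quadratic
  remainder, and so does \<open>\<mu> t / sqrt (V t)\<close> from \<open>b * (t - tc) / sqrt (V tc)\<close>
  (\<open>standardized_drift_expansion\<close>). The threshold is chosen so that this linear term equals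
  \<open>- z / sqrt m\<close>, with \<open>z\<close> the upper quantile. The argument of the normal distribution function is thus
  \<open>z + O(1 / sqrt m)\<close>, and its value is \<open>1 - \<alpha> + O(1 / sqrt m)\<close>.

  The Berry--Esseen bound for bounded summands (\<open>berry_esseen_bounded\<close>) is proved by Stein's method.
  If \<open>f\<close> solves Stein's equation for a test function \<open>h\<close>, each bounded mean-zero summand contributes to the
  expectation of \<open>W * f W\<close> an average of \<open>f'\<close> near \<open>W\<close>. Inserting the equation into this average,
  rather than into \<open>f' W\<close> itself, bounds the distribution function of \<open>W\<close> directly by that of the normal
  law at a slightly shifted point.
\<close>

section \<open>The standard normal distribution function\<close>

abbreviation std_normal_cdf :: "real \<Rightarrow> real" where
  "std_normal_cdf \<equiv> cdf std_normal_distribution"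

text \<open>
  Continuity and integrability on the whole line let the fundamental theorem of calculus apply to
  the compact piece \<open>{w - 1..v}\<close>; what lies to the left of it does not depend on \<open>v\<close>. The integrands
  of interest are the normal density and the normal density times a bounded continuous function.
\<close>

lemma has_real_derivative_integral_atMost:
  fixes q :: "real \<Rightarrow> real"
  assumes "continuous_on UNIV q" "integrable lborel q"
  shows "((\<lambda>w. LINT x|lborel. indicator {..w} x * q x) has_real_derivative q w) (at w)"
proof -
  let ?A = "\<lambda>w. LINT x|lborel. indicator {..w} x * q x"
  have set_int: "set_integrable lborel S q" if "S \<in> sets borel" for S
    unfolding set_integrable_def using that assms(2)
    by (intro integrable_mult_indicator) auto
  have A: "?A v = ?A (w - 1) + integral {w - 1..v} q" if "v \<in> {w - 1..w + 1}" for v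
  proof -
    have "?A v = (LINT x:{..w - 1}|lborel. q x) + (LINT x:{w - 1<..v}|lborel. q x)"
      using that unfolding set_lebesgue_integral_def[symmetric]
      by (subst set_integral_Un[symmetric])
         (auto intro!: set_int simp: ivl_disj_un set_lebesgue_integral_def)
    also have "(LINT x:{w - 1<..v}|lborel. q x) = (LINT x:{w - 1..v}|lborel. q x)"
      using AE_lborel_singleton[of "w - 1"]
      unfolding set_lebesgue_integral_def
      by (intro integral_cong_AE)
         (use assms(2) in \<open>auto simp: indicator_def elim!: eventually_mono\<close>)
    also have "\<dots> = integral {w - 1..v} q"
      by (intro set_borel_integral_eq_integral set_int) auto
    finally show ?thesis by (simp add: set_lebesgue_integral_def)
  qed
  have D: "((\<lambda>v. ?A (w - 1) + integral {w - 1..v} q) has_real_derivative q w) (at w)"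
  proof -
    have "((\<lambda>v. integral {w - 1..v} q) has_real_derivative q w) (at w within {w - 1..w + 1})"
      using assms(1) by (intro integral_has_real_derivative) (auto intro: continuous_on_subset)
    then have "((\<lambda>v. integral {w - 1..v} q) has_real_derivative q w) (at w)"
      by (simp add: at_within_Icc_at)
    then show ?thesis by (auto intro!: derivative_eq_intros)
  qed
  show ?thesis
  proof (rule has_field_derivative_transform_within_open[OF D])
    show "open {w - 1<..<w + 1}" "w \<in> {w - 1<..<w + 1}" by auto
    show "?A (w - 1) + integral {w - 1..v} q = ?A v" if "v \<in> {w - 1<..<w + 1}" for v
      using A[of v] that by simp
  qed
qed

lemma std_normal_cdf_eq_integral:
  "std_normal_cdf w = (LINT x|lborel. indicator {..w} x * std_normal_density x)"
proof -
  have "std_normal_cdf w = (LINT x|std_normal_distribution. indicator {..w} x)"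
    by (simp add: cdf_def2)
  also have "\<dots> = (LINT x|lborel. indicator {..w} x * std_normal_density x)"
    by (subst integral_density) (auto simp: mult.commute)
  finally show ?thesis .
qed

lemma continuous_on_std_normal_density: "continuous_on S std_normal_density"
  unfolding std_normal_density_def by (intro continuous_intros) auto

lemma has_real_derivative_std_normal_cdf:
  "(std_normal_cdf has_real_derivative std_normal_density w) (at w)"
  using has_real_derivative_integral_atMost[OF continuous_on_std_normal_density, of w]
  by (simp add: std_normal_cdf_eq_integral[abs_def] integrable_std_normal_moment[of 0, simplified])

lemma has_real_derivative_std_normal_density:
  "(std_normal_density has_real_derivative - w * std_normal_density w) (at w)"
proof -
  have "((\<lambda>x. exp (- x\<^sup>2 / 2)) has_real_derivative - w * exp (- w\<^sup>2 / 2)) (at w)"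
    by (auto intro!: derivative_eq_intros)
  from DERIV_cmult[OF this, of "1 / sqrt (2 * pi)"] show ?thesis
    unfolding std_normal_density_def by (simp only: mult.left_commute)
qed

lemma std_normal_density_le_1: "std_normal_density x \<le> 1"
proof -
  have "1 \<le> sqrt (2 * pi)" using pi_gt3 by simp
  moreover have "exp (- x\<^sup>2 / 2) \<le> 1" by simp
  ultimately have "1 / sqrt (2 * pi) * exp (- x\<^sup>2 / 2) \<le> 1 * 1"
    by (intro mult_mono) (auto simp only: divide_le_eq_1 exp_ge_zero)
  then show ?thesis unfolding std_normal_density_def by simp
qed

lemma std_normal_cdf_lipschitz: "\<bar>std_normal_cdf x - std_normal_cdf y\<bar> \<le> \<bar>x - y\<bar>"
proof -
  have "norm (std_normal_cdf x - std_normal_cdf y) \<le> 1 * norm (x - y)"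
    using has_real_derivative_std_normal_cdf std_normal_density_le_1
    by (intro field_differentiable_bound[of UNIV, where f' = std_normal_density])
       (auto simp: abs_le_iff intro: order_trans[of _ 0])
  then show ?thesis by simp
qed

interpretation std_normal: real_distribution std_normal_distribution
  by (rule real_dist_normal_dist)

text \<open>
  The sum of the two distribution functions has derivative \<open>0\<close> because the density is even, and it
  tends to \<open>1\<close> at infinity.
\<close>

lemma std_normal_cdf_minus: "std_normal_cdf (- w) = 1 - std_normal_cdf w"
proof -
  let ?s = "\<lambda>w. std_normal_cdf w + std_normal_cdf (- w)"
  have "(?s has_real_derivative 0) (at x)" for x
  proof -
    have "(?s has_real_derivative std_normal_density x + std_normal_density (- x) * - 1) (at x)"
      by (intro DERIV_add DERIV_chain2[where g = uminus] has_real_derivative_std_normal_cdf)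
         (auto intro!: derivative_eq_intros)
    then show ?thesis by (simp add: std_normal_density_def)
  qed
  then have const: "?s x = ?s w" for x
    by (intro DERIV_isconst_all) auto
  have "((\<lambda>w. std_normal_cdf (- w)) \<longlongrightarrow> 0) at_top"
    by (rule filterlim_compose[OF std_normal.cdf_lim_at_bot filterlim_uminus_at_bot_at_top])
  then have "(?s \<longlongrightarrow> 1 + 0) at_top"
    by (intro tendsto_add std_normal.cdf_lim_at_top_prob)
  moreover have "?s = (\<lambda>_. ?s w)"
    using const by blast
  ultimately have "((\<lambda>_::real. ?s w) \<longlongrightarrow> 1) at_top"
    by (metis add_0_right)
  then have "?s w = 1"
    by (simp only: tendsto_const_iff trivial_limit_at_top_linorder not_False_eq_True)
  then show ?thesis by simp
qed

lemma std_normal_upper_tail: "measure std_normal_distribution {z<..} = 1 - std_normal_cdf z"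
  using std_normal.prob_compl[of "{..z}"] by (simp add: cdf_def2 Compl_eq_Diff_UNIV[symmetric])

lemma upper_normal_quantile_exists:
  assumes "0 < \<alpha>" "\<alpha> < 1"
  shows "\<exists>!z. measure std_normal_distribution {z<..} = \<alpha>"
proof -
  have strict: "std_normal_cdf x < std_normal_cdf y" if "x < y" for x y
    by (rule DERIV_pos_imp_increasing[OF that])
       (use has_real_derivative_std_normal_cdf normal_density_pos[of 1 0] in auto)
  have "\<forall>\<^sub>F x in at_bot. std_normal_cdf x < 1 - \<alpha>"
    using order_tendstoD(2)[OF std_normal.cdf_lim_at_bot, of "1 - \<alpha>"] assms by simp
  then obtain l where l: "std_normal_cdf l < 1 - \<alpha>"
    by (auto simp: eventually_at_bot_linorder)
  have "\<forall>\<^sub>F x in at_top. 1 - \<alpha> < std_normal_cdf x"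
    using order_tendstoD(1)[OF std_normal.cdf_lim_at_top_prob, of "1 - \<alpha>"] assms by simp
  then obtain u where u: "1 - \<alpha> < std_normal_cdf u"
    by (auto simp: eventually_at_top_linorder)
  have "l \<le> u" using l u strict[of u l] by (cases "l \<le> u") auto
  have "\<exists>z\<ge>l. z \<le> u \<and> std_normal_cdf z = 1 - \<alpha>"
    using l u \<open>l \<le> u\<close> DERIV_isCont[OF has_real_derivative_std_normal_cdf]
    by (intro IVT) auto
  then obtain z where "std_normal_cdf z = 1 - \<alpha>" by auto
  moreover have "x = y" if "std_normal_cdf x = std_normal_cdf y" for x y
    using strict[of x y] strict[of y x] that by (cases x y rule: linorder_cases) auto
  ultimately show ?thesis unfolding std_normal_upper_tail
    by (intro ex1I[of _ z]) (auto simp: algebra_simps)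
qed

lemma std_normal_cdf_upper_normal_quantile:
  assumes "0 < \<alpha>" "\<alpha> < 1"
  shows "std_normal_cdf (upper_normal_quantile \<alpha>) = 1 - \<alpha>"
proof -
  have "measure std_normal_distribution {upper_normal_quantile \<alpha><..} = \<alpha>"
    unfolding upper_normal_quantile_def by (rule theI'[OF upper_normal_quantile_exists[OF assms]])
  then show ?thesis
    by (simp add: std_normal_upper_tail)
qed

section \<open>Stein's equation for the normal law\<close>

text \<open>
  The difference of \<open>std_normal_density w / w\<close> and the upper tail is decreasing in \<open>w\<close> and vanishes at
  infinity, so it is nonnegative.
\<close>

lemma mills_ratio_bound:
  assumes "0 < w"
  shows "w * (1 - std_normal_cdf w) \<le> std_normal_density w"
proof -
  let ?D = "\<lambda>w. std_normal_density w / w - (1 - std_normal_cdf w)"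
  have D: "(?D has_real_derivative - std_normal_density x / x\<^sup>2) (at x)" if "0 < x" for x
    using that
    by (auto intro!: derivative_eq_intros has_real_derivative_std_normal_density
          has_real_derivative_std_normal_cdf simp: field_simps power2_eq_square)
  have "?D x \<le> ?D w" if "w \<le> x" for x
  proof (rule DERIV_nonpos_imp_nonincreasing[OF that], intro exI conjI)
    fix y assume "w \<le> y"
    then show "(?D has_real_derivative - std_normal_density y / y\<^sup>2) (at y)"
      using assms by (intro D) auto
    show "- std_normal_density y / y\<^sup>2 \<le> 0" by simp
  qed
  then have "\<forall>\<^sub>F x in at_top. ?D x \<le> ?D w"
    by (auto intro: eventually_mono[OF eventually_ge_at_top[of w]])
  moreover have "((\<lambda>x. std_normal_density x / x) \<longlongrightarrow> 0) at_top"
  proof (rule tendsto_sandwich[OF _ _ tendsto_const])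
    show "\<forall>\<^sub>F x in at_top. 0 \<le> std_normal_density x / x"
      by (auto intro: eventually_mono[OF eventually_gt_at_top[of 0]])
    show "\<forall>\<^sub>F x in at_top. std_normal_density x / x \<le> 1 / x"
      by (auto intro: eventually_mono[OF eventually_gt_at_top[of 0]]
          intro!: divide_right_mono std_normal_density_le_1)
    show "((\<lambda>x::real. 1 / x) \<longlongrightarrow> 0) at_top" by real_asymp
  qed
  then have "(?D \<longlongrightarrow> 0 - (1 - 1)) at_top"
    by (intro tendsto_intros std_normal.cdf_lim_at_top_prob)
  ultimately have "0 \<le> ?D w"
    by (intro tendsto_upperbound[of ?D 0 at_top]) auto
  then show ?thesis using assms by (simp add: field_simps)
qed

text \<open>
  The Mills bound handles \<open>w \<ge> 1\<close>; on \<open>[0, 1]\<close> the density is at least \<open>1 / 6\<close> and the tail at most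
  \<open>1\<close>.
\<close>

lemma std_normal_tail_le_density:
  assumes "0 \<le> w"
  shows "1 - std_normal_cdf w \<le> 6 * std_normal_density w"
proof (cases "1 \<le> w")
  case True
  have "1 - std_normal_cdf w \<le> w * (1 - std_normal_cdf w)"
    using True std_normal.cdf_bounded_prob[of w]
    by (intro mult_right_mono[of 1 w, simplified]) auto
  then show ?thesis
    using mills_ratio_bound[of w] True normal_density_nonneg[of 0 1 w] by linarith
next
  case False
  have "sqrt (2 * pi) \<le> 3"
    using pi_less_4 by (intro real_le_lsqrt) auto
  moreover have "1 / 2 \<le> exp (- w\<^sup>2 / 2)"
  proof -
    have "w\<^sup>2 \<le> 1" using assms False by (simp add: power_le_one)
    then show ?thesis using exp_ge_add_one_self[of "- w\<^sup>2 / 2"] by simp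
  qed
  ultimately have "1 \<le> 6 * std_normal_density w"
    by (simp add: std_normal_density_def field_simps)
  then show ?thesis using std_normal.cdf_nonneg[of w] by simp
qed

text \<open>
  Stein's equation \<open>f' w - w * f w = h w - Nh\<close> has the integrating factor \<open>exp (- w ^ 2 / 2)\<close>; its bounded
  solution is the integral of \<open>h - Nh\<close> against the normal law over \<open>{..w}\<close>, divided by the density.
  As \<open>h - Nh\<close> has normal mean zero, the integral over \<open>{..w}\<close> is minus the one over \<open>{w<..}\<close>.
  It is therefore bounded by the smaller of the two tails, that is, by the tail beyond \<open>\<bar>w\<bar>\<close>,
  and the two preceding bounds on this tail give the two bounds on \<open>f\<close>.
\<close>

lemma stein_solution_exists:
  fixes h :: "real \<Rightarrow> real"
  assumes h: "continuous_on UNIV h" "\<And>x. 0 \<le> h x" "\<And>x. h x \<le> 1"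
  defines "Nh \<equiv> (LINT x|std_normal_distribution. h x)"
  obtains f where "\<And>w. (f has_real_derivative w * f w + (h w - Nh)) (at w)"
    "\<And>w. \<bar>f w\<bar> \<le> 6" "\<And>w. \<bar>w * f w\<bar> \<le> 1"
proof -
  let ?\<phi> = std_normal_density
  define q where "q x = (h x - Nh) * ?\<phi> x" for x
  define A where "A w = (LINT x|lborel. indicator {..w} x * q x)" for w
  have [measurable]: "h \<in> borel_measurable borel"
    by (rule borel_measurable_continuous_onI[OF h(1)])
  have int_h: "integrable std_normal_distribution h"
    using h by (intro std_normal.integrable_const_bound[of _ 1]) auto
  have "0 \<le> Nh" "Nh \<le> 1"
    unfolding Nh_def using h int_h
    by (auto intro!: integral_nonneg_AE std_normal.integral_le_const)
  then have k: "\<bar>h x - Nh\<bar> \<le> 1" for x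
    using h(2)[of x] h(3)[of x] by linarith
  have q_le: "\<bar>q x\<bar> \<le> ?\<phi> x" for x
    unfolding q_def using mult_right_mono[OF k[of x], of "?\<phi> x"] by (simp add: abs_mult)
  have int_\<phi>: "integrable lborel ?\<phi>"
    using integrable_std_normal_moment[of 0] by simp
  have q_meas [measurable]: "q \<in> borel_measurable borel"
    unfolding q_def by measurable
  have int_q: "integrable lborel q"
    by (rule Bochner_Integration.integrable_bound[OF int_\<phi>]) (use q_le in auto)
  have q0: "(LINT x|lborel. q x) = 0"
  proof -
    have "(LINT x|lborel. q x) = (LINT x|std_normal_distribution. h x - Nh)"
      unfolding q_def by (subst integral_density) (auto simp: mult.commute)
    also have "\<dots> = 0"
      using int_h std_normal.prob_space by (simp add: Nh_def)
    finally show ?thesis .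
  qed
  have ind_int: "integrable lborel (\<lambda>x. indicator S x * r x)"
    if "integrable lborel r" "S \<in> sets borel" for r :: "real \<Rightarrow> real" and S
    using integrable_mult_indicator[of S lborel r] that by simp
  have lower: "\<bar>A w\<bar> \<le> std_normal_cdf w" for w
  proof -
    have "\<bar>A w\<bar> \<le> (LINT x|lborel. \<bar>indicator {..w} x * q x\<bar>)"
      unfolding A_def by (rule integral_abs_bound)
    also have "\<dots> \<le> (LINT x|lborel. indicator {..w} x * ?\<phi> x)"
      by (intro integral_mono ind_int int_\<phi> int_q integrable_abs)
         (auto simp: abs_mult intro!: mult_left_mono q_le)
    finally show ?thesis by (simp add: std_normal_cdf_eq_integral)
  qed
  have upper: "\<bar>A w\<bar> \<le> 1 - std_normal_cdf w" for w
  proof -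
    have split: "(LINT x|lborel. indicator {..w} x * r x) + (LINT x|lborel. indicator {w<..} x * r x)
        = (LINT x|lborel. r x)" if "integrable lborel r" for r :: "real \<Rightarrow> real"
      by (subst Bochner_Integration.integral_add[symmetric])
         (auto intro!: ind_int that intro: Bochner_Integration.integral_cong
           split: split_indicator)
    have "\<bar>A w\<bar> = \<bar>LINT x|lborel. indicator {w<..} x * q x\<bar>"
      using split[OF int_q] q0 by (simp add: A_def)
    also have "\<dots> \<le> (LINT x|lborel. \<bar>indicator {w<..} x * q x\<bar>)"
      by (rule integral_abs_bound)
    also have "\<dots> \<le> (LINT x|lborel. indicator {w<..} x * ?\<phi> x)"
      by (intro integral_mono ind_int int_\<phi> int_q integrable_abs)
         (auto simp: abs_mult intro!: mult_left_mono q_le)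
    also have "\<dots> = 1 - std_normal_cdf w"
      using split[OF int_\<phi>] integral_std_normal_moment_even[of 0]
      by (simp add: std_normal_cdf_eq_integral)
    finally show ?thesis .
  qed
  have A_le_tail: "\<bar>A w\<bar> \<le> 1 - std_normal_cdf \<bar>w\<bar>" for w
    using lower[of w] upper[of w] std_normal_cdf_minus[of w] by (cases "0 \<le> w") auto
  have \<phi>_pos: "0 < ?\<phi> w" for w by (simp add: normal_density_pos)
  have \<phi>_abs: "?\<phi> \<bar>w\<bar> = ?\<phi> w" for w by (simp add: std_normal_density_def)
  show thesis
  proof
    fix w
    have "continuous_on UNIV q"
      unfolding q_def by (intro continuous_intros h continuous_on_std_normal_density)
    then have "(A has_real_derivative q w) (at w)"
      using has_real_derivative_integral_atMost[OF _ int_q, of w] by (simp add: A_def[abs_def])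
    then have "((\<lambda>w. A w / ?\<phi> w) has_real_derivative
        (q w * ?\<phi> w - A w * (- w * ?\<phi> w)) / (?\<phi> w * ?\<phi> w)) (at w)"
      using \<phi>_pos[of w] by (intro DERIV_divide has_real_derivative_std_normal_density) auto
    also have "(q w * ?\<phi> w - A w * (- w * ?\<phi> w)) / (?\<phi> w * ?\<phi> w) = w * (A w / ?\<phi> w) + (h w - Nh)"
      using \<phi>_pos[of w] by (simp add: q_def field_simps)
    finally show "((\<lambda>w. A w / ?\<phi> w) has_real_derivative w * (A w / ?\<phi> w) + (h w - Nh)) (at w)" .
    show "\<bar>A w / ?\<phi> w\<bar> \<le> 6"
      using A_le_tail[of w] std_normal_tail_le_density[of "\<bar>w\<bar>"] \<phi>_pos[of w]
      by (simp add: \<phi>_abs abs_divide pos_divide_le_eq)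
    show "\<bar>w * (A w / ?\<phi> w)\<bar> \<le> 1"
    proof (cases "w = 0")
      case False
      have "\<bar>w\<bar> * \<bar>A w\<bar> \<le> \<bar>w\<bar> * (1 - std_normal_cdf \<bar>w\<bar>)"
        by (intro mult_left_mono A_le_tail) auto
      also have "\<dots> \<le> ?\<phi> w"
        using mills_ratio_bound[of "\<bar>w\<bar>"] False by (simp add: \<phi>_abs)
      finally show ?thesis using \<phi>_pos[of w] by (simp add: abs_mult abs_divide)
    qed auto
  qed
qed

text \<open>
  The derivative of \<open>v * f v\<close> is \<open>f v + v * f' v\<close>, where \<open>\<bar>f' v\<bar> \<le> 2\<close> by Stein's equation. It grows only
  linearly in \<open>v\<close>, so its effect on a sum of unit variance is of order \<open>\<delta>\<close> in expectation.
\<close>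

lemma stein_lipschitz:
  fixes f h :: "real \<Rightarrow> real"
  assumes f: "\<And>w. (f has_real_derivative w * f w + (h w - Nh)) (at w)"
    "\<And>w. \<bar>f w\<bar> \<le> 6" "\<And>w. \<bar>w * f w\<bar> \<le> 1" and k: "\<And>w. \<bar>h w - Nh\<bar> \<le> 1"
    and close: "\<bar>u - w\<bar> \<le> \<delta>" "\<delta> \<le> 1"
  shows "\<bar>u * f u - w * f w\<bar> \<le> (8 + 2 * \<bar>w\<bar>) * \<delta>"
proof -
  have "norm (u * f u - w * f w) \<le> (8 + 2 * \<bar>w\<bar>) * norm (u - w)"
  proof (rule field_differentiable_bound[where S = "{min u w..max u w}"
        and f = "\<lambda>v. v * f v" and f' = "\<lambda>v. f v + v * (v * f v + (h v - Nh))"])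
    fix v assume v: "v \<in> {min u w..max u w}"
    show "((\<lambda>v. v * f v) has_field_derivative f v + v * (v * f v + (h v - Nh)))
        (at v within {min u w..max u w})"
      using DERIV_mult[OF DERIV_ident f(1)[of v]]
      by (rule has_field_derivative_at_within[OF DERIV_cong]) (simp add: algebra_simps)
    have "\<bar>v * f v + (h v - Nh)\<bar> \<le> 2"
      using f(3)[of v] k[of v] by linarith
    then have "\<bar>v * (v * f v + (h v - Nh))\<bar> \<le> \<bar>v\<bar> * 2"
      unfolding abs_mult by (intro mult_left_mono) auto
    moreover have "\<bar>v\<bar> \<le> \<bar>w\<bar> + 1"
      using v close by (auto simp: min_def max_def split: if_splits)
    ultimately show "norm (f v + v * (v * f v + (h v - Nh))) \<le> 8 + 2 * \<bar>w\<bar>"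
      using f(2)[of v] unfolding real_norm_def by linarith
  qed auto
  also have "\<dots> \<le> (8 + 2 * \<bar>w\<bar>) * \<delta>"
    using close by (intro mult_left_mono) auto
  finally show ?thesis by simp
qed

section \<open>A Berry--Esseen bound for bounded summands\<close>

context prob_space
begin

text \<open>
  Write \<open>W\<close> for the sum and \<open>R i\<close> for the sum without \<open>\<xi> i\<close>. Since \<open>\<xi> i\<close> has mean zero and is independent
  of \<open>R i\<close>, the expectation of \<open>\<xi> i * f W\<close> equals that of \<open>\<xi> i * (f (R i + \<xi> i) - f (R i))\<close>, which by the mean
  value theorem is an expectation of \<open>(\<xi> i) ^ 2\<close> times a value of \<open>f'\<close> at distance at most \<open>\<delta>\<close> from \<open>R i\<close>.
  Replacing \<open>f' u\<close> by \<open>u * f u + h u - Nh\<close> and summing over \<open>i\<close>, the two terms of the form \<open>W * f W\<close> cancel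
  up to \<open>O(\<delta>)\<close>, and what remains bounds the probability of \<open>W \<le> z\<close> by \<open>Nh + O(\<delta>)\<close>, because the
  test function \<open>h\<close> is \<open>1\<close> up to \<open>z + 2 * \<delta>\<close> and so \<open>W \<le> z\<close> forces \<open>h u = 1\<close> at every point \<open>u\<close> that
  occurs.
\<close>

lemma berry_esseen_upper_small:
  fixes \<xi> :: "'i \<Rightarrow> 'a \<Rightarrow> real"
  assumes I: "finite I" and indep: "indep_vars (\<lambda>_. borel) \<xi> I"
    and bound: "\<And>i \<omega>. i \<in> I \<Longrightarrow> \<omega> \<in> space M \<Longrightarrow> \<bar>\<xi> i \<omega>\<bar> \<le> \<delta>"
    and mean: "\<And>i. i \<in> I \<Longrightarrow> expectation (\<xi> i) = 0"
    and var: "(\<Sum>i\<in>I. expectation (\<lambda>\<omega>. (\<xi> i \<omega>)\<^sup>2)) = 1"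
    and \<delta>: "0 < \<delta>" "\<delta> \<le> 1"
  shows "prob {\<omega> \<in> space M. (\<Sum>i\<in>I. \<xi> i \<omega>) \<le> z} \<le> std_normal_cdf z + 25 * \<delta>"
proof -
  define W where "W \<omega> = (\<Sum>i\<in>I. \<xi> i \<omega>)" for \<omega>
  define R where "R i \<omega> = (\<Sum>j\<in>I - {i}. \<xi> j \<omega>)" for i \<omega>
  have W_split: "W \<omega> = R i \<omega> + \<xi> i \<omega>" if "i \<in> I" for i \<omega>
    using that I by (simp add: W_def R_def sum.remove[of I i])
  have [measurable]: "\<xi> i \<in> borel_measurable M" if "i \<in> I" for i
    using indep that by (auto simp: indep_vars_def)
  have W_meas [measurable]: "W \<in> borel_measurable M"
    unfolding W_def by (intro borel_measurable_sum) auto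
  have R_meas [measurable]: "R i \<in> borel_measurable M" for i
    unfolding R_def by (intro borel_measurable_sum) auto
  have W_bound: "\<bar>W \<omega>\<bar> \<le> card I * \<delta>" if "\<omega> \<in> space M" for \<omega>
  proof -
    have "\<bar>W \<omega>\<bar> \<le> (\<Sum>i\<in>I. \<bar>\<xi> i \<omega>\<bar>)" unfolding W_def by (rule sum_abs)
    also have "\<dots> \<le> card I * \<delta>" using that by (intro sum_bounded_above bound)
    finally show ?thesis .
  qed
  have R_bound: "\<bar>R i \<omega>\<bar> \<le> card I * \<delta> + \<delta>" if "\<omega> \<in> space M" "i \<in> I" for i \<omega>
    using W_bound[OF that(1)] bound[OF that(2,1)] W_split[OF that(2), of \<omega>] by linarith
  have bdd_int: "integrable M X" if "X \<in> borel_measurable M" "\<And>\<omega>. \<omega> \<in> space M \<Longrightarrow> \<bar>X \<omega>\<bar> \<le> B"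
    for X :: "'a \<Rightarrow> real" and B
    using that by (intro integrable_const_bound[of _ B]) auto
  have indep_R: "expectation (\<lambda>\<omega>. u (\<xi> i \<omega>) * v (R i \<omega>))
      = expectation (\<lambda>\<omega>. u (\<xi> i \<omega>)) * expectation (\<lambda>\<omega>. v (R i \<omega>))"
    if i: "i \<in> I" and [measurable]: "u \<in> borel_measurable borel" "v \<in> borel_measurable borel"
      and int: "integrable M (\<lambda>\<omega>. u (\<xi> i \<omega>))" "integrable M (\<lambda>\<omega>. v (R i \<omega>))"
    for i and u v :: "real \<Rightarrow> real"
  proof -
    have "indep_var borel (\<xi> i) borel (R i)"
      unfolding R_def using I i indep by (intro indep_vars_sum) (auto simp: insert_absorb)
    then have "indep_var borel (u \<circ> \<xi> i) borel (v \<circ> R i)"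
      by (rule indep_var_compose) measurable
    then show ?thesis
      using int by (intro indep_var_lebesgue_integral) (simp_all add: comp_def)
  qed
  have int_\<xi>: "integrable M (\<xi> i)" if "i \<in> I" for i
    using that by (intro bdd_int[of _ \<delta>] bound) auto
  have int_\<xi>2: "integrable M (\<lambda>\<omega>. (\<xi> i \<omega>)\<^sup>2)" if "i \<in> I" for i
    using that bound[of i] \<delta> by (intro bdd_int[of _ "\<delta>\<^sup>2"]) (auto intro!: abs_le_square_iff[THEN iffD1])
  have int_R: "integrable M (R i)" if "i \<in> I" for i
    by (rule bdd_int[of _ "card I * \<delta> + \<delta>"]) (use R_bound that in auto)
  have int_W: "integrable M W" by (rule bdd_int[of _ "card I * \<delta>"]) (use W_bound in auto)
  have int_W2: "integrable M (\<lambda>\<omega>. (W \<omega>)\<^sup>2)"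
    using W_bound by (intro bdd_int[of _ "(card I * \<delta>)\<^sup>2"])
       (use \<delta> in \<open>auto intro!: abs_le_square_iff[THEN iffD1]\<close>)
  have E_abs_W: "expectation (\<lambda>\<omega>. \<bar>W \<omega>\<bar>) \<le> 1"
  proof -
    have "expectation (\<lambda>\<omega>. \<xi> i \<omega> * W \<omega>) = expectation (\<lambda>\<omega>. (\<xi> i \<omega>)\<^sup>2)" if i: "i \<in> I" for i
    proof -
      have RX: "integrable M (\<lambda>\<omega>. \<xi> i \<omega> * R i \<omega>)"
        using bound[OF i] R_bound[OF _ i] \<delta> i
        by (intro bdd_int[of _ "\<delta> * (card I * \<delta> + \<delta>)"]) (auto simp: abs_mult intro!: mult_mono)
      have "expectation (\<lambda>\<omega>. \<xi> i \<omega> * W \<omega>) = expectation (\<lambda>\<omega>. \<xi> i \<omega> * R i \<omega> + (\<xi> i \<omega>)\<^sup>2)"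
        by (simp add: W_split[OF i] algebra_simps power2_eq_square)
      also have "\<dots> = expectation (\<lambda>\<omega>. \<xi> i \<omega> * R i \<omega>) + expectation (\<lambda>\<omega>. (\<xi> i \<omega>)\<^sup>2)"
        by (intro Bochner_Integration.integral_add RX int_\<xi>2 i)
      also have "expectation (\<lambda>\<omega>. \<xi> i \<omega> * R i \<omega>) = 0"
        using indep_R[OF i, of "\<lambda>x. x" "\<lambda>x. x"] mean[OF i] int_\<xi>[OF i] int_R[OF i] by simp
      finally show ?thesis by simp
    qed
    moreover have "integrable M (\<lambda>\<omega>. \<xi> i \<omega> * W \<omega>)" if i: "i \<in> I" for i
      using bound[OF i] W_bound \<delta> i
      by (intro bdd_int[of _ "\<delta> * (card I * \<delta>)"]) (auto simp: abs_mult intro!: mult_mono)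
    moreover have "(W \<omega>)\<^sup>2 = (\<Sum>i\<in>I. \<xi> i \<omega> * W \<omega>)" for \<omega>
      by (simp add: power2_eq_square W_def sum_distrib_right)
    ultimately have "expectation (\<lambda>\<omega>. (W \<omega>)\<^sup>2) = 1"
      using var by (simp add: Bochner_Integration.integral_sum)
    moreover have "expectation (\<lambda>\<omega>. \<bar>W \<omega>\<bar>) \<le> expectation (\<lambda>\<omega>. (1 + (W \<omega>)\<^sup>2) / 2)"
    proof (intro integral_mono integrable_abs int_W)
      show "integrable M (\<lambda>\<omega>. (1 + (W \<omega>)\<^sup>2) / 2)" using int_W2 by auto
      show "\<bar>W \<omega>\<bar> \<le> (1 + (W \<omega>)\<^sup>2) / 2" for \<omega>
        using sum_squares_ge_zero[of "\<bar>W \<omega>\<bar> - 1" 0] by (simp add: power2_eq_square algebra_simps)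
    qed
    ultimately show ?thesis using int_W2 prob_space by simp
  qed

  \<comment> \<open>A ramp from 1 at z + 2 * \<delta> to 0 at z + 3 * \<delta>. The step of length \<delta> makes f differentiable
    everywhere, the shift by 2 * \<delta> covers both the gap between W and R i and the gap between
    R i and the intermediate point of the mean value theorem.\<close>
  define h where "h x = max 0 (min 1 ((z + 3 * \<delta> - x) / \<delta>))" for x
  define Nh where "Nh = (LINT x|std_normal_distribution. h x)"
  have h: "continuous_on UNIV h" "\<And>x. 0 \<le> h x" "\<And>x. h x \<le> 1"
    unfolding h_def using \<delta> by (auto intro!: continuous_intros)
  have h1: "h x = 1" if "x \<le> z + 2 * \<delta>" for x
    using that \<delta> by (simp add: h_def field_simps)
  have h_meas: "h \<in> borel_measurable borel"
    by (rule borel_measurable_continuous_onI[OF h(1)])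
  have int_h: "integrable std_normal_distribution h"
    using h h_meas by (intro std_normal.integrable_const_bound[of _ 1]) auto
  have "Nh \<le> (LINT x|std_normal_distribution. indicator {..z + 3 * \<delta>} x)"
    unfolding Nh_def using int_h \<delta>
    by (intro integral_mono)
       (auto simp: h_def indicator_def field_simps
         intro!: std_normal.integrable_const_bound[of _ 1])
  also have "\<dots> = std_normal_cdf (z + 3 * \<delta>)" by (simp add: cdf_def2)
  also have "\<dots> \<le> std_normal_cdf z + 3 * \<delta>"
    using std_normal_cdf_lipschitz[of "z + 3 * \<delta>" z] \<delta> by auto
  finally have Nh_le: "Nh \<le> std_normal_cdf z + 3 * \<delta>" .
  have "0 \<le> Nh" "Nh \<le> 1"
    unfolding Nh_def using h int_h
    by (auto intro!: integral_nonneg_AE std_normal.integral_le_const)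
  then have k: "\<bar>h x - Nh\<bar> \<le> 1" for x
    using h(2)[of x] h(3)[of x] by linarith
  obtain f where f: "\<And>w. (f has_real_derivative w * f w + (h w - Nh)) (at w)"
    "\<And>w. \<bar>f w\<bar> \<le> 6" "\<And>w. \<bar>w * f w\<bar> \<le> 1"
    using stein_solution_exists[OF h] unfolding Nh_def by blast
  have f_meas [measurable]: "f \<in> borel_measurable borel"
    by (rule borel_measurable_continuous_onI)
       (use DERIV_isCont[OF f(1)] in \<open>auto simp: continuous_on_eq_continuous_at\<close>)

  \<comment> \<open>V w is a lower bound for the derivative of f at all points within \<delta> of w.\<close>
  define V where "V w = w * f w + indicator {..z + \<delta>} w - Nh - (8 + 2 * \<bar>w\<bar>) * \<delta>" for w
  have V_meas [measurable]: "V \<in> borel_measurable borel"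
    unfolding V_def by measurable
  have taylor: "x\<^sup>2 * V w \<le> x * (f (w + x) - f w)" if x: "\<bar>x\<bar> \<le> \<delta>" for x w
  proof (cases "x = 0")
    case False
    have "\<exists>u. \<bar>u - w\<bar> \<le> \<delta> \<and> f (w + x) - f w = x * (u * f u + (h u - Nh))"
    proof (cases "0 < x")
      case True
      then obtain u where "w < u" "u < w + x"
        "f (w + x) - f w = (w + x - w) * (u * f u + (h u - Nh))"
        using MVT2[of w "w + x" f "\<lambda>u. u * f u + (h u - Nh)"] f(1) by auto
      then show ?thesis using x by (intro exI[of _ u]) auto
    next
      case neg: False
      with False obtain u where "w + x < u" "u < w"
        "f w - f (w + x) = (w - (w + x)) * (u * f u + (h u - Nh))"
        using MVT2[of "w + x" w f "\<lambda>u. u * f u + (h u - Nh)"] f(1) by auto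
      then show ?thesis using x by (intro exI[of _ u]) auto
    qed
    then obtain u where u: "\<bar>u - w\<bar> \<le> \<delta>" "f (w + x) - f w = x * (u * f u + (h u - Nh))"
      by blast
    have "indicator {..z + \<delta>} w \<le> h u"
      using u(1) h(2)[of u] h1[of u] by (auto simp: indicator_def)
    then have "V w \<le> u * f u + (h u - Nh)"
      using stein_lipschitz[OF f k u(1) \<delta>(2)] unfolding V_def by linarith
    then have "x\<^sup>2 * V w \<le> x\<^sup>2 * (u * f u + (h u - Nh))"
      by (intro mult_left_mono) auto
    then show ?thesis by (simp add: u(2) power2_eq_square mult.assoc)
  qed auto

  \<comment> \<open>The 22 is 10 + 12: the expectations of 8 + 2 * \<bar>W\<bar> and of 10 + 2 * \<bar>W\<bar> are at most 10 and 12.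
    The first is the price of passing from R i to W in w * f w, the second bounds the
    error term of V at R i, because \<bar>R i\<bar> \<le> \<bar>W\<bar> + 1.\<close>
  define B where "B = expectation (\<lambda>\<omega>. W \<omega> * f (W \<omega>))
    + prob {\<omega> \<in> space M. W \<omega> \<le> z} - Nh - 22 * \<delta>"
  have int_WfW: "integrable M (\<lambda>\<omega>. W \<omega> * f (W \<omega>))"
    using f(3) by (intro bdd_int[of _ 1]) auto
  have int_V: "integrable M (\<lambda>\<omega>. V (R i \<omega>))" if i: "i \<in> I" for i
  proof -
    have "integrable M (\<lambda>\<omega>. R i \<omega> * f (R i \<omega>))"
      using f(3) by (intro bdd_int[of _ 1]) auto
    moreover have "integrable M (\<lambda>\<omega>. indicator {..z + \<delta>} (R i \<omega>) :: real)"
      by (intro bdd_int[of _ 1]) (auto simp: indicator_def)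
    ultimately show ?thesis
      unfolding V_def using int_R[OF i] by auto
  qed
  have EV: "B \<le> expectation (\<lambda>\<omega>. V (R i \<omega>))" if i: "i \<in> I" for i
  proof -
    let ?L = "\<lambda>\<omega>. W \<omega> * f (W \<omega>) + indicator {\<omega> \<in> space M. W \<omega> \<le> z} \<omega>
        - (Nh + 18 * \<delta>) - 2 * \<delta> * \<bar>W \<omega>\<bar>"
    have pointwise: "?L \<omega> - 2 * \<delta> * \<bar>W \<omega>\<bar> \<le> V (R i \<omega>)" if \<omega>: "\<omega> \<in> space M" for \<omega>
    proof -
      have close: "\<bar>R i \<omega> - W \<omega>\<bar> \<le> \<delta>"
        using bound[OF i \<omega>] W_split[OF i, of \<omega>] by auto
      have "W \<omega> * f (W \<omega>) - (8 + 2 * \<bar>W \<omega>\<bar>) * \<delta> \<le> R i \<omega> * f (R i \<omega>)"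
        using stein_lipschitz[OF f k close \<delta>(2)] by linarith
      moreover have "(8 + 2 * \<bar>R i \<omega>\<bar>) * \<delta> \<le> (10 + 2 * \<bar>W \<omega>\<bar>) * \<delta>"
        using close \<delta> by (intro mult_right_mono) auto
      moreover have "indicator {\<omega> \<in> space M. W \<omega> \<le> z} \<omega> \<le> (indicator {..z + \<delta>} (R i \<omega>) :: real)"
        using close by (auto simp: indicator_def)
      ultimately show ?thesis unfolding V_def by (simp add: algebra_simps)
    qed
    have int_ind: "integrable M (indicator {\<omega> \<in> space M. W \<omega> \<le> z} :: 'a \<Rightarrow> real)"
      by (intro bdd_int[of _ 1]) (auto simp: indicator_def)
    have "B \<le> expectation (\<lambda>\<omega>. ?L \<omega> - 2 * \<delta> * \<bar>W \<omega>\<bar>)"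
      using E_abs_W \<delta> int_W int_WfW int_ind prob_space mult_left_mono[OF E_abs_W, of \<delta>]
      by (simp add: B_def algebra_simps)
    also have "\<dots> \<le> expectation (\<lambda>\<omega>. V (R i \<omega>))"
      using int_W int_WfW int_ind by (intro integral_mono int_V i pointwise) auto
    finally show ?thesis .
  qed
  have E_prod: "expectation (\<lambda>\<omega>. (\<xi> i \<omega>)\<^sup>2) * B \<le> expectation (\<lambda>\<omega>. \<xi> i \<omega> * f (W \<omega>))"
    if i: "i \<in> I" for i
  proof -
    have int1: "integrable M (\<lambda>\<omega>. \<xi> i \<omega> * f (W \<omega>))" "integrable M (\<lambda>\<omega>. \<xi> i \<omega> * f (R i \<omega>))"
      using bound[OF i] f(2) \<delta> i
      by (auto intro!: bdd_int[of _ "\<delta> * 6"] mult_mono simp: abs_mult)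
    have int2: "integrable M (\<lambda>\<omega>. (\<xi> i \<omega>)\<^sup>2 * V (R i \<omega>))"
    proof (rule Bochner_Integration.integrable_bound)
      show "integrable M (\<lambda>\<omega>. \<delta>\<^sup>2 * V (R i \<omega>))" using int_V[OF i] by auto
      show "AE \<omega> in M. norm ((\<xi> i \<omega>)\<^sup>2 * V (R i \<omega>)) \<le> norm (\<delta>\<^sup>2 * V (R i \<omega>))"
        using bound[OF i] \<delta>
        by (auto simp: abs_mult intro!: mult_right_mono abs_le_square_iff[THEN iffD1])
    qed (use i in measurable)
    have "expectation (\<lambda>\<omega>. \<xi> i \<omega> * f (R i \<omega>)) = 0"
      using indep_R[OF i, of "\<lambda>x. x" f] mean[OF i] int_\<xi>[OF i] f(2)
      by (simp add: bdd_int[of _ 6])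
    then have "expectation (\<lambda>\<omega>. \<xi> i \<omega> * f (W \<omega>))
        = expectation (\<lambda>\<omega>. \<xi> i \<omega> * f (W \<omega>) - \<xi> i \<omega> * f (R i \<omega>))"
      using int1 by simp
    also have "\<dots> \<ge> expectation (\<lambda>\<omega>. (\<xi> i \<omega>)\<^sup>2 * V (R i \<omega>))"
      using taylor[OF bound[OF i]]
      by (intro integral_mono int2 Bochner_Integration.integrable_diff int1)
         (auto simp: W_split[OF i] right_diff_distrib)
    also have "expectation (\<lambda>\<omega>. (\<xi> i \<omega>)\<^sup>2 * V (R i \<omega>))
        = expectation (\<lambda>\<omega>. (\<xi> i \<omega>)\<^sup>2) * expectation (\<lambda>\<omega>. V (R i \<omega>))"
      using indep_R[OF i, of "\<lambda>x. x\<^sup>2" V] int_\<xi>2[OF i] int_V[OF i] by simp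
    also have "\<dots> \<ge> expectation (\<lambda>\<omega>. (\<xi> i \<omega>)\<^sup>2) * B"
      by (intro mult_left_mono EV i) auto
    finally show ?thesis .
  qed
  have "B = (\<Sum>i\<in>I. expectation (\<lambda>\<omega>. (\<xi> i \<omega>)\<^sup>2)) * B"
    using var by simp
  also have "\<dots> = (\<Sum>i\<in>I. expectation (\<lambda>\<omega>. (\<xi> i \<omega>)\<^sup>2) * B)"
    by (rule sum_distrib_right)
  also have "\<dots> \<le> (\<Sum>i\<in>I. expectation (\<lambda>\<omega>. \<xi> i \<omega> * f (W \<omega>)))"
    by (intro sum_mono E_prod)
  also have "\<dots> = expectation (\<lambda>\<omega>. W \<omega> * f (W \<omega>))"
  proof -
    have "integrable M (\<lambda>\<omega>. \<xi> i \<omega> * f (W \<omega>))" if i: "i \<in> I" for i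
      using bound[OF i] f(2) \<delta> i by (auto intro!: bdd_int[of _ "\<delta> * 6"] mult_mono simp: abs_mult)
    moreover have "W \<omega> * f (W \<omega>) = (\<Sum>i\<in>I. \<xi> i \<omega> * f (W \<omega>))" for \<omega>
      by (simp add: W_def sum_distrib_right)
    ultimately show ?thesis by (simp add: Bochner_Integration.integral_sum)
  qed
  finally have "prob {\<omega> \<in> space M. W \<omega> \<le> z} \<le> Nh + 22 * \<delta>" by (simp add: B_def)
  then show ?thesis using Nh_le by (simp add: W_def)
qed

text \<open>
  For \<open>\<delta> > 1\<close> the bound exceeds \<open>1\<close>.
\<close>

lemma berry_esseen_upper:
  fixes \<xi> :: "'i \<Rightarrow> 'a \<Rightarrow> real"
  assumes I: "finite I" and indep: "indep_vars (\<lambda>_. borel) \<xi> I"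
    and bound: "\<And>i \<omega>. i \<in> I \<Longrightarrow> \<omega> \<in> space M \<Longrightarrow> \<bar>\<xi> i \<omega>\<bar> \<le> \<delta>"
    and mean: "\<And>i. i \<in> I \<Longrightarrow> expectation (\<xi> i) = 0"
    and var: "(\<Sum>i\<in>I. expectation (\<lambda>\<omega>. (\<xi> i \<omega>)\<^sup>2)) = 1"
  shows "prob {\<omega> \<in> space M. (\<Sum>i\<in>I. \<xi> i \<omega>) \<le> z} \<le> std_normal_cdf z + 25 * \<delta>"
proof (cases "\<delta> \<le> 1")
  case True
  have "0 < \<delta>"
  proof (rule ccontr)
    assume "\<not> 0 < \<delta>"
    then have "\<xi> i \<omega> = 0" if "i \<in> I" "\<omega> \<in> space M" for i \<omega>
      using bound[OF that] by auto
    then have "expectation (\<lambda>\<omega>. (\<xi> i \<omega>)\<^sup>2) = 0" if "i \<in> I" for i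
      using that by (subst Bochner_Integration.integral_cong[where g = "\<lambda>_. 0"]) auto
    then show False using var by simp
  qed
  then show ?thesis using berry_esseen_upper_small[OF assms _ True] by blast
next
  case False
  then show ?thesis
    using prob_le_1[of "{\<omega> \<in> space M. (\<Sum>i\<in>I. \<xi> i \<omega>) \<le> z}"] std_normal.cdf_nonneg[of z]
    by linarith
qed

text \<open>
  The lower bound on the distribution function is the upper bound for the negated summands.
\<close>

lemma berry_esseen_bounded:
  fixes \<xi> :: "'i \<Rightarrow> 'a \<Rightarrow> real"
  assumes I: "finite I" and indep: "indep_vars (\<lambda>_. borel) \<xi> I"
    and bound: "\<And>i \<omega>. i \<in> I \<Longrightarrow> \<omega> \<in> space M \<Longrightarrow> \<bar>\<xi> i \<omega>\<bar> \<le> \<delta>"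
    and mean: "\<And>i. i \<in> I \<Longrightarrow> expectation (\<xi> i) = 0"
    and var: "(\<Sum>i\<in>I. expectation (\<lambda>\<omega>. (\<xi> i \<omega>)\<^sup>2)) = 1"
  shows "\<bar>prob {\<omega> \<in> space M. (\<Sum>i\<in>I. \<xi> i \<omega>) \<le> z} - std_normal_cdf z\<bar> \<le> 25 * \<delta>"
proof -
  let ?W = "\<lambda>\<omega>. \<Sum>i\<in>I. \<xi> i \<omega>"
  have [measurable]: "\<xi> i \<in> borel_measurable M" if "i \<in> I" for i
    using indep that by (auto simp: indep_vars_def)
  have W [measurable]: "?W \<in> borel_measurable M"
    by (intro borel_measurable_sum) auto
  have "prob {\<omega> \<in> space M. (\<Sum>i\<in>I. - \<xi> i \<omega>) \<le> - z} \<le> std_normal_cdf (- z) + 25 * \<delta>"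
  proof (rule berry_esseen_upper[OF I])
    show "indep_vars (\<lambda>_. borel) (\<lambda>i \<omega>. - \<xi> i \<omega>) I"
      using indep by (rule indep_vars_compose2) auto
  qed (use bound mean var in auto)
  moreover have "1 - prob {\<omega> \<in> space M. ?W \<omega> \<le> z} = prob {\<omega> \<in> space M. \<not> ?W \<omega> \<le> z}"
    by (rule prob_neg[symmetric]) measurable
  moreover have "prob {\<omega> \<in> space M. \<not> ?W \<omega> \<le> z} \<le> prob {\<omega> \<in> space M. (\<Sum>i\<in>I. - \<xi> i \<omega>) \<le> - z}"
    by (intro finite_measure_mono) (auto simp: sum_negf)
  ultimately show ?thesis
    using berry_esseen_upper[OF assms, of z] std_normal_cdf_minus[of z] by linarith
qed

end

section \<open>The false discovery proportion as a sum of bounded terms\<close>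

text \<open>
  This turns the ratio into a sum of independent terms. When nothing is rejected the numerator is
  \<open>0\<close> and the denominator \<open>1\<close>, and both sides hold; otherwise one multiplies by the positive number
  of rejections.
\<close>

lemma FDP_le_iff:
  assumes "0 \<le> c"
  shows "FDP m P H \<omega> t \<le> c \<longleftrightarrow>
    (\<Sum>i=1..m. of_bool (P i \<omega> \<le> t) * (1 - of_bool (H i \<omega>) - c)) \<le> 0"
proof -
  define V where "V = (\<Sum>i=1..m. of_bool (P i \<omega> \<le> t) * (1 - of_bool (H i \<omega>)) :: real)"
  define R where "R = (\<Sum>i=1..m. of_bool (P i \<omega> \<le> t) :: real)"
  have diff: "(\<Sum>i=1..m. of_bool (P i \<omega> \<le> t) * (1 - of_bool (H i \<omega>) - c)) = V - c * R"
    unfolding V_def R_def sum_distrib_left sum_subtractf[symmetric]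
    by (intro sum.cong) (simp_all add: algebra_simps)
  show ?thesis
  proof (cases "\<forall>i\<in>{1..m}. P i \<omega> > t")
    case True
    then have "V = 0" "R = 0" by (auto simp: V_def R_def not_le intro!: sum.neutral)
    then show ?thesis
      using assms unfolding diff FDP_def V_def[symmetric] by simp
  next
    case False
    then obtain i where "i \<in> {1..m}" "P i \<omega> \<le> t" by (auto simp: not_less)
    then have "of_bool (P i \<omega> \<le> t) \<le> R"
      unfolding R_def by (intro member_le_sum) auto
    then have "0 < R" using \<open>P i \<omega> \<le> t\<close> by simp
    moreover have "FDP m P H \<omega> t = V / R"
      using False by (simp only: FDP_def V_def[symmetric] R_def[symmetric]) simp
    ultimately show ?thesis
      unfolding diff by (simp add: pos_divide_le_eq)
  qed
qed

text \<open>
  On the diagonal, the covariance kernel is the variance of \<open>of_bool (P \<le> t) * (1 - of_bool H - c)\<close>: the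
  variable takes the value \<open>1 - c\<close> with probability \<open>(1 - a) * t\<close> and the value \<open>- c\<close> with probability
  \<open>a * F t\<close>, and the squared term is its squared mean.
\<close>

lemma K_Omega_diag:
  "K_Omega a c F t t = (1 - c)\<^sup>2 * ((1 - a) * t) + c\<^sup>2 * (a * F t)
    - ((1 - a) * t - c * marginal_cdf a F t)\<^sup>2"
  unfolding K_Omega_def marginal_cdf_def by (simp add: power2_eq_square algebra_simps)

context mixture_sample
begin

lemma pair_measurable: "i \<in> {1..m} \<Longrightarrow>
    (\<lambda>\<omega>. (P i \<omega>, H i \<omega>)) \<in> M \<rightarrow>\<^sub>M borel \<Otimes>\<^sub>M count_space UNIV"
  using indep by (auto simp: indep_vars_def)

lemma P_measurable: "i \<in> {1..m} \<Longrightarrow> P i \<in> borel_measurable M"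
  using measurable_compose[OF pair_measurable measurable_fst] by simp

lemma H_measurable: "i \<in> {1..m} \<Longrightarrow> H i \<in> M \<rightarrow>\<^sub>M count_space UNIV"
  using measurable_compose[OF pair_measurable measurable_snd] by simp

lemma prob_alternative:
  assumes "i \<in> {1..m}" "0 \<le> a" "a \<le> 1"
  shows "prob {\<omega> \<in> space M. H i \<omega>} = a"
proof -
  note [measurable] = H_measurable[OF assms(1)]
  have "prob {\<omega> \<in> space M. H i \<omega>} = measure (distr M (count_space UNIV) (H i)) {True}"
    by (subst measure_distr) (auto intro!: arg_cong[where f = prob])
  also have "\<dots> = a"
    using assms by (simp add: bernoulli measure_pmf_single)
  finally show ?thesis .
qed

lemma prob_null:
  assumes "i \<in> {1..m}" "0 \<le> a" "a \<le> 1"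
  shows "prob {\<omega> \<in> space M. \<not> H i \<omega>} = 1 - a"
proof -
  note [measurable] = H_measurable[OF assms(1)]
  have "prob {\<omega> \<in> space M. \<not> H i \<omega>} = 1 - prob {\<omega> \<in> space M. H i \<omega>}"
    by (rule prob_neg) measurable
  then show ?thesis using prob_alternative[OF assms] by simp
qed

lemma prob_null_rejection:
  assumes "i \<in> {1..m}" "0 \<le> a" "a < 1" "t \<in> {0..1}"
  shows "prob {\<omega> \<in> space M. P i \<omega> \<le> t \<and> \<not> H i \<omega>} = (1 - a) * t"
  using null_uniform[of i t] prob_null[of i] assms by (simp add: cond_prob_def field_simps)

lemma prob_alternative_rejection:
  assumes "i \<in> {1..m}" "0 < a" "a \<le> 1"
  shows "prob {\<omega> \<in> space M. P i \<omega> \<le> t \<and> H i \<omega>} = a * F t"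
  using alternative_cdf[of i t] prob_alternative[of i] assms by (simp add: cond_prob_def field_simps)

text \<open>
  The summands of the linearised event have mean \<open>\<mu>\<close> and variance \<open>K_Omega a c F t t\<close>, and once centred
  they are bounded by \<open>2\<close>. The estimate is explicit in \<open>t\<close>, so it may be used at thresholds that vary with
  the sample size.
\<close>

lemma FDP_normal_approximation:
  assumes m: "0 < m" and a: "0 < a" "a < 1" and c: "0 \<le> c" "c \<le> 1" and t: "t \<in> {0..1}"
    and K: "0 < K_Omega a c F t t"
  defines "\<mu> \<equiv> (1 - a) * t - c * marginal_cdf a F t"
  shows "\<bar>prob {\<omega> \<in> space M. FDP m P H \<omega> t \<le> c}
      - std_normal_cdf (- (sqrt m * (\<mu> / sqrt (K_Omega a c F t t))))\<bar>
    \<le> 50 / sqrt (m * K_Omega a c F t t)"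
proof -
  define V where "V = K_Omega a c F t t"
  define x where "x p b = of_bool (p \<le> t) * (1 - of_bool b - c)" for p :: real and b :: bool
  define X where "X i \<omega> = x (P i \<omega>) (H i \<omega>)" for i \<omega>
  define \<xi> where "\<xi> i \<omega> = (X i \<omega> - \<mu>) / sqrt (m * V)" for i \<omega>
  have mV: "0 < m * V" using m K by (simp add: V_def)
  have [measurable]: "(\<lambda>p. x (fst p) (snd p)) \<in> borel_measurable (borel \<Otimes>\<^sub>M count_space UNIV)"
    unfolding x_def by measurable
  have X_meas [measurable]: "X i \<in> borel_measurable M" if "i \<in> {1..m}" for i
    using measurable_compose[OF pair_measurable[OF that], of "\<lambda>p. x (fst p) (snd p)" borel]
    by (simp add: X_def[abs_def])
  have X_bound: "\<bar>X i \<omega>\<bar> \<le> 1" for i \<omega>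
    using c by (auto simp: X_def x_def)
  have moments: "expectation (X i) = \<mu>"
    "expectation (\<lambda>\<omega>. (X i \<omega>)\<^sup>2) = (1 - c)\<^sup>2 * ((1 - a) * t) + c\<^sup>2 * (a * F t)"
    if i: "i \<in> {1..m}" for i
  proof -
    note [measurable] = P_measurable[OF i] H_measurable[OF i]
    let ?N = "{\<omega> \<in> space M. P i \<omega> \<le> t \<and> \<not> H i \<omega>}" and ?A = "{\<omega> \<in> space M. P i \<omega> \<le> t \<and> H i \<omega>}"
    have ind: "integrable M (indicator ?N :: 'a \<Rightarrow> real)" "integrable M (indicator ?A :: 'a \<Rightarrow> real)"
      by (auto intro!: integrable_const_bound[of _ 1] simp: indicator_def)
    have "expectation (X i) = expectation (\<lambda>\<omega>. (1 - c) * indicator ?N \<omega> + (- c) * indicator ?A \<omega>)"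
      by (intro Bochner_Integration.integral_cong) (auto simp: X_def x_def)
    also have "\<dots> = (1 - c) * prob ?N + (- c) * prob ?A"
      using ind by simp
    finally show "expectation (X i) = \<mu>"
      using prob_null_rejection[OF i _ _ t] prob_alternative_rejection[OF i, of t] a
      by (simp add: \<mu>_def marginal_cdf_def algebra_simps)
    have "expectation (\<lambda>\<omega>. (X i \<omega>)\<^sup>2)
        = expectation (\<lambda>\<omega>. (1 - c)\<^sup>2 * indicator ?N \<omega> + c\<^sup>2 * indicator ?A \<omega>)"
      by (intro Bochner_Integration.integral_cong) (auto simp: X_def x_def)
    also have "\<dots> = (1 - c)\<^sup>2 * prob ?N + c\<^sup>2 * prob ?A"
      using ind by simp
    finally show "expectation (\<lambda>\<omega>. (X i \<omega>)\<^sup>2) = (1 - c)\<^sup>2 * ((1 - a) * t) + c\<^sup>2 * (a * F t)"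
      using prob_null_rejection[OF i _ _ t] prob_alternative_rejection[OF i, of t] a by simp
  qed
  have int_X: "integrable M (X i)" "integrable M (\<lambda>\<omega>. (X i \<omega>)\<^sup>2)" if "i \<in> {1..m}" for i
    using that X_bound by (auto intro!: integrable_const_bound[of _ 1] simp: abs_square_le_1)
  have \<mu>_bound: "\<bar>\<mu>\<bar> \<le> 1"
  proof -
    have "1 \<in> {1..m}" using m by auto
    from moments(1)[OF this] int_X(1)[OF this] X_bound[of 1]
    show ?thesis
      using integral_abs_bound[of M "X 1"] integral_le_const[of "\<lambda>\<omega>. \<bar>X 1 \<omega>\<bar>" 1] by auto
  qed
  have \<xi>_moments: "expectation (\<xi> i) = 0" "expectation (\<lambda>\<omega>. (\<xi> i \<omega>)\<^sup>2) = 1 / m"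
    if i: "i \<in> {1..m}" for i
  proof -
    show "expectation (\<xi> i) = 0"
      unfolding \<xi>_def using int_X[OF i] moments[OF i] prob_space by simp
    have "(\<xi> i \<omega>)\<^sup>2 = ((X i \<omega>)\<^sup>2 - 2 * \<mu> * X i \<omega> + \<mu>\<^sup>2) / (m * V)" for \<omega>
      using mV by (simp add: \<xi>_def power_divide power2_eq_square algebra_simps)
    then have "expectation (\<lambda>\<omega>. (\<xi> i \<omega>)\<^sup>2)
        = (expectation (\<lambda>\<omega>. (X i \<omega>)\<^sup>2) - 2 * \<mu> * expectation (X i) + \<mu>\<^sup>2) / (m * V)"
      using int_X[OF i] prob_space by simp
    also have "expectation (\<lambda>\<omega>. (X i \<omega>)\<^sup>2) - 2 * \<mu> * expectation (X i) + \<mu>\<^sup>2 = V"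
      unfolding moments[OF i] V_def K_Omega_diag \<mu>_def by (simp add: power2_eq_square)
    finally show "expectation (\<lambda>\<omega>. (\<xi> i \<omega>)\<^sup>2) = 1 / m" using K by (simp add: V_def)
  qed
  have approx: "\<bar>prob {\<omega> \<in> space M. (\<Sum>i\<in>{1..m}. \<xi> i \<omega>) \<le> - (sqrt m * (\<mu> / sqrt V))}
      - std_normal_cdf (- (sqrt m * (\<mu> / sqrt V)))\<bar> \<le> 25 * (2 / sqrt (m * V))"
  proof (rule berry_esseen_bounded)
    have "indep_vars (\<lambda>_. borel) (\<lambda>i \<omega>. (\<lambda>p. (x (fst p) (snd p) - \<mu>) / sqrt (m * V)) (P i \<omega>, H i \<omega>)) {1..m}"
      by (rule indep_vars_compose2[OF indep]) measurable
    then show "indep_vars (\<lambda>_. borel) \<xi> {1..m}"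
      by (simp add: \<xi>_def[abs_def] X_def)
    show "\<bar>\<xi> i \<omega>\<bar> \<le> 2 / sqrt (m * V)" for i \<omega>
      unfolding \<xi>_def abs_divide using X_bound[of i \<omega>] \<mu>_bound mV
      by (auto intro!: divide_mono)
    show "(\<Sum>i\<in>{1..m}. expectation (\<lambda>\<omega>. (\<xi> i \<omega>)\<^sup>2)) = 1"
      using m \<xi>_moments(2) by simp
  qed (use \<xi>_moments in auto)
  have event: "(\<Sum>i\<in>{1..m}. \<xi> i \<omega>) \<le> - (sqrt m * (\<mu> / sqrt V)) \<longleftrightarrow> FDP m P H \<omega> t \<le> c" for \<omega>
  proof -
    have "(\<Sum>i\<in>{1..m}. \<xi> i \<omega>) = ((\<Sum>i\<in>{1..m}. X i \<omega>) - m * \<mu>) / sqrt (m * V)"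
      by (simp add: \<xi>_def sum_divide_distrib[symmetric] sum_subtractf)
    moreover have "- (sqrt m * (\<mu> / sqrt V)) = (- (m * \<mu>)) / sqrt (m * V)"
      using m K by (simp add: V_def real_sqrt_mult field_simps)
    ultimately have "(\<Sum>i\<in>{1..m}. \<xi> i \<omega>) \<le> - (sqrt m * (\<mu> / sqrt V)) \<longleftrightarrow> (\<Sum>i\<in>{1..m}. X i \<omega>) \<le> 0"
      using mV by (simp only: divide_le_cancel) (simp add: real_sqrt_gt_0_iff[THEN iffD2])
    then show ?thesis
      unfolding FDP_le_iff[OF c(1)] by (simp only: X_def x_def)
  qed
  show ?thesis
    using approx unfolding event by (simp add: V_def)
qed

end

section \<open>Expansion of the drift at the critical threshold\<close>

text \<open>
  Replacing \<open>V t\<close> by \<open>V t0\<close> changes \<open>1 / sqrt (V t)\<close> only to first order, and this change is multiplied by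
  the drift, which is itself of first order because it vanishes at \<open>t0\<close>.
\<close>

lemma standardized_drift_expansion:
  fixes \<mu> V :: "real \<Rightarrow> real"
  assumes \<mu>: "(\<lambda>t. \<mu> t - b * (t - t0)) \<in> O[at t0](\<lambda>t. (t - t0)\<^sup>2)"
    and V: "(V has_real_derivative V') (at t0)" "0 < V t0"
  shows "(\<lambda>t. \<mu> t / sqrt (V t) - b * (t - t0) / sqrt (V t0)) \<in> O[at t0](\<lambda>t. (t - t0)\<^sup>2)"
proof -
  define r where "r t = 1 / sqrt (V t)" for t
  have "\<exists>D. (r has_real_derivative D) (at t0)"
    unfolding r_def using V by (intro exI) (auto intro!: derivative_eq_intros)
  then obtain D where r: "(r has_real_derivative D) (at t0)" ..
  have r_bounded: "r \<in> O[at t0](\<lambda>_. 1)"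
    using DERIV_isCont[OF r] by (intro bigoI_tendsto[of _ _ "r t0"]) (auto simp: isCont_def)
  have r_diff: "(\<lambda>t. r t - r t0) \<in> O[at t0](\<lambda>t. t - t0)"
    using r by (intro bigoI_tendsto[of _ _ D])
       (auto simp: has_field_derivative_iff eventually_at_filter)
  have "(\<lambda>t. (\<mu> t - b * (t - t0)) * r t) \<in> O[at t0](\<lambda>t. (t - t0)\<^sup>2 * 1)"
    by (intro landau_o.big.mult \<mu> r_bounded)
  moreover have "(\<lambda>t. (b * (t - t0)) * (r t - r t0)) \<in> O[at t0](\<lambda>t. (t - t0) * (t - t0))"
    by (intro landau_o.big.mult r_diff) auto
  ultimately have "(\<lambda>t. (\<mu> t - b * (t - t0)) * r t + (b * (t - t0)) * (r t - r t0))
      \<in> O[at t0](\<lambda>t. (t - t0)\<^sup>2)"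
    by (intro sum_in_bigo) (simp_all add: power2_eq_square)
  then show ?thesis by (simp add: r_def algebra_simps diff_divide_distrib)
qed

text \<open>
  By the mean value theorem the remainder is \<open>t - t0\<close> times an increment of \<open>g\<close>, so the Lipschitz condition
  at the single point \<open>t0\<close> already gives a quadratic remainder.
\<close>

lemma first_order_expansion:
  fixes G g :: "real \<Rightarrow> real"
  assumes t0: "t0 \<in> {l<..<u}" and G: "\<And>t. t \<in> {l<..<u} \<Longrightarrow> (G has_real_derivative g t) (at t)"
    and g: "(\<lambda>t. g t - g t0) \<in> O[at t0](\<lambda>t. t - t0)"
  shows "(\<lambda>t. G t - G t0 - g t0 * (t - t0)) \<in> O[at t0](\<lambda>t. (t - t0)\<^sup>2)"
proof -
  obtain L where L: "0 < L" "\<forall>\<^sub>F t in at t0. norm (g t - g t0) \<le> L * norm (t - t0)"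
    using g by (rule landau_o.bigE)
  then obtain d where d: "0 < d"
    "\<And>t. t \<noteq> t0 \<Longrightarrow> dist t t0 < d \<Longrightarrow> norm (g t - g t0) \<le> L * norm (t - t0)"
    unfolding eventually_at by auto
  have "norm (G t - G t0 - g t0 * (t - t0)) \<le> L * norm ((t - t0)\<^sup>2)"
    if t: "t \<noteq> t0" "dist t t0 < d" "t \<in> {l<..<u}" for t
  proof -
    have "\<exists>\<xi>. \<xi> \<noteq> t0 \<and> \<bar>\<xi> - t0\<bar> \<le> \<bar>t - t0\<bar> \<and> G t - G t0 = (t - t0) * g \<xi>"
    proof (cases "t0 < t")
      case True
      then obtain \<xi> where "t0 < \<xi>" "\<xi> < t" "G t - G t0 = (t - t0) * g \<xi>"
        using MVT2[of t0 t G g] G t0 t by auto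
      then show ?thesis by (intro exI[of _ \<xi>]) auto
    next
      case False
      then obtain \<xi> where "t < \<xi>" "\<xi> < t0" "G t0 - G t = (t0 - t) * g \<xi>"
        using MVT2[of t t0 G g] G t0 t by auto
      then show ?thesis by (intro exI[of _ \<xi>]) (auto simp: algebra_simps)
    qed
    then obtain \<xi> where \<xi>: "\<xi> \<noteq> t0" "\<bar>\<xi> - t0\<bar> \<le> \<bar>t - t0\<bar>" "G t - G t0 = (t - t0) * g \<xi>"
      by blast
    have "norm (G t - G t0 - g t0 * (t - t0)) = \<bar>t - t0\<bar> * \<bar>g \<xi> - g t0\<bar>"
      unfolding \<xi>(3) real_norm_def abs_mult[symmetric] by (simp add: algebra_simps)
    also have "\<dots> \<le> \<bar>t - t0\<bar> * (L * \<bar>t - t0\<bar>)"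
    proof (intro mult_left_mono)
      have "\<bar>g \<xi> - g t0\<bar> \<le> L * \<bar>\<xi> - t0\<bar>"
        using d(2)[of \<xi>] \<xi> t(2) by (simp add: dist_real_def)
      also have "\<dots> \<le> L * \<bar>t - t0\<bar>" using \<xi>(2) L(1) by (intro mult_left_mono) auto
      finally show "\<bar>g \<xi> - g t0\<bar> \<le> L * \<bar>t - t0\<bar>" .
    qed auto
    finally show ?thesis by (simp add: power2_eq_square abs_mult mult_ac)
  qed
  moreover have "\<forall>\<^sub>F t in at t0. t \<in> {l<..<u}"
    using t0 by (intro eventually_at_in_open') auto
  moreover have "\<forall>\<^sub>F t in at t0. t \<noteq> t0 \<and> dist t t0 < d"
    unfolding eventually_at using d(1) by auto
  ultimately have "\<forall>\<^sub>F t in at t0. norm (G t - G t0 - g t0 * (t - t0)) \<le> L * norm ((t - t0)\<^sup>2)"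
    by (auto elim: eventually_elim2)
  then show ?thesis by (rule landau_o.bigI[OF L(1)])
qed

text \<open>
  Concavity makes the difference quotients from \<open>x\<close> towards \<open>y\<close> decrease with the step, so the directional
  derivative is at least the quotient for half the way to \<open>y\<close>. Stopping at the midpoint, where \<open>G\<close> lies strictly above
  the chord, keeps the inequality strict in the limit.
\<close>

lemma strictly_concave_tangent:
  assumes conc: "strictly_concave_on S G" and S: "x \<in> S" "y \<in> S" "x \<noteq> y"
    and G: "(G has_real_derivative d) (at x)"
  shows "G y < G x + d * (y - x)"
proof -
  have conc': "(1 - u) * G x + u * G y < G ((1 - u) * x + u * y)" if "0 < u" "u < 1" for u
    using conc S that unfolding strictly_concave_on_def by blast
  define p where "p u = G (x + u * (y - x))" for u
  have half: "2 * (p (1 / 2) - G x) \<le> d * (y - x)"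
  proof (rule tendsto_lowerbound)
    have "((\<lambda>u. x + u * (y - x)) has_real_derivative y - x) (at 0)"
      by (auto intro!: derivative_eq_intros)
    moreover have "(G has_real_derivative d) (at (x + 0 * (y - x)))" using G by simp
    ultimately have "(p has_real_derivative d * (y - x)) (at 0)"
      unfolding p_def by (rule DERIV_chain2[rotated])
    then have "((\<lambda>u. (p u - p 0) / (u - 0)) \<longlongrightarrow> d * (y - x)) (at 0)"
      unfolding has_field_derivative_iff .
    then show "((\<lambda>u. (p u - G x) / u) \<longlongrightarrow> d * (y - x)) (at_right 0)"
      by (auto intro: tendsto_within_subset simp: p_def)
    have "2 * (p (1 / 2) - G x) \<le> (p u - G x) / u" if u: "0 < u" "u < 1 / 2" for u
    proof -
      define z where "z = x + (1 / 2) * (y - x)"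
      have "convex S" using conc by (simp add: strictly_concave_on_def)
      then have "(1 - 1 / 2) *\<^sub>R x + (1 / 2) *\<^sub>R y \<in> S"
        using S by (intro convexD_alt) auto
      moreover have "z = (1 - 1 / 2) *\<^sub>R x + (1 / 2) *\<^sub>R y"
        by (simp add: z_def field_simps)
      ultimately have z: "z \<in> S" "x \<noteq> z" using S by (auto simp: z_def)
      have "(1 - 2 * u) * G x + (2 * u) * G z < G ((1 - 2 * u) * x + (2 * u) * z)"
        using conc S z u unfolding strictly_concave_on_def by force
      also have "(1 - 2 * u) * x + (2 * u) * z = x + u * (y - x)"
        by (simp add: z_def field_simps)
      finally have "2 * (p (1 / 2) - G x) * u \<le> p u - G x"
        by (simp add: p_def z_def algebra_simps)
      then show ?thesis using u by (simp add: pos_le_divide_eq)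
    qed
    then show "\<forall>\<^sub>F u in at_right 0. 2 * (p (1 / 2) - G x) \<le> (p u - G x) / u"
      by (intro eventually_at_rightI[of 0 "1 / 2"]) auto
  qed auto
  have "(1 - 1 / 2) * G x + 1 / 2 * G y < G ((1 - 1 / 2) * x + 1 / 2 * y)"
    by (rule conc') auto
  also have "(1 - 1 / 2) * x + 1 / 2 * y = x + 1 / 2 * (y - x)"
    by (simp add: field_simps)
  finally have "(1 - 1 / 2) * G x + 1 / 2 * G y < p (1 / 2)" unfolding p_def .
  then show ?thesis using half by simp
qed

section \<open>The probability of keeping the false discovery proportion below the level\<close>

theorem theorem6p1:
  fixes a c \<alpha> tc :: real
    and F g :: "real \<Rightarrow> real"
    and M :: "nat \<Rightarrow> 'a measure"
    and P :: "nat \<Rightarrow> nat \<Rightarrow> 'a \<Rightarrow> real"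
    and H :: "nat \<Rightarrow> nat \<Rightarrow> 'a \<Rightarrow> bool"
  assumes a: "0 \<le> a" "a \<le> 1"
    and F_cdf: "unit_interval_cdf F"
    and F_ge: "\<And>t. t \<in> {0..1} \<Longrightarrow> t \<le> F t"
    and F_ne_U: "\<exists>t\<in>{0..1}. F t \<noteq> t"
    and G_concave: "strictly_concave_on {0..1} (marginal_cdf a F)"
    and G_density: "has_density_derivative (marginal_cdf a F) g"
    and sample: "\<And>m. mixture_sample (M m) m a F (P m) (H m)"
    and \<alpha>: "0 < \<alpha>" "\<alpha> < 1"
    and c: "0 < c" "c < 1"
    and tc: "0 < tc" "tc < 1" "Q_fun a F tc = c"
    and g_Lipschitz_at_tc: "(\<lambda>t. g t - g tc) \<in> O[at tc](\<lambda>t. t - tc)"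
  shows "(\<lambda>m. measure (M m) {\<omega> \<in> space (M m). FDP m (P m) (H m) \<omega> (t_cm a c F g tc \<alpha> m) \<le> c}
              - (1 - \<alpha>))
         \<in> O(\<lambda>m. 1 / sqrt (real m))"
proof -
  define G where "G = marginal_cdf a F"
  have aF: "a * F t = G t - (1 - a) * t" for t
    by (simp add: G_def marginal_cdf_def)
  have G_deriv: "(G has_real_derivative g t) (at t)" if "t \<in> {0<..<1}" for t
    using G_density that by (simp add: has_density_derivative_def G_def)
  have "(g has_integral G 0) {0..0}"
    using G_density unfolding has_density_derivative_def G_def
    by (metis atLeastAtMost_iff order_refl zero_le_one)
  then have G0: "G 0 = 0"
    using has_integral_refl(2)[of g 0] by (simp add: has_integral_unique)
  have Q: "(1 - a) * tc / G tc = c"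
    using tc by (simp add: Q_fun_def G_def)
  then have "G tc \<noteq> 0" using c by auto
  then have fixpoint: "(1 - a) * tc = c * G tc"
    using Q by (simp add: field_simps)
  have a1: "a < 1"
    using fixpoint a c \<open>G tc \<noteq> 0\<close> by (cases "a = 1") auto
  \<comment> \<open>For a = 0 the marginal distribution function is linear.\<close>
  have "a \<noteq> 0"
  proof
    assume "a = 0"
    then have "G = (\<lambda>t. t)" by (simp add: G_def marginal_cdf_def fun_eq_iff)
    moreover have "(1 - 1 / 2) * G 0 + 1 / 2 * G 1 < G ((1 - 1 / 2) * 0 + 1 / 2 * 1)"
      using G_concave[folded G_def] unfolding strictly_concave_on_def
      by (elim conjE ballE[of _ _ 0] ballE[of _ _ 1] allE[of _ "1 / 2"]) auto
    ultimately show False by simp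
  qed
  with a have a0: "0 < a" by simp
  define b where "b = 1 - a - c * g tc"
  \<comment> \<open>The drift of the linearised event at tc has slope b. It is positive because the tangent of
    G at tc lies strictly above G at 0, so that g tc < G tc / tc = (1 - a) / c.\<close>
  have "G 0 < G tc + g tc * (0 - tc)"
    using G_concave tc by (intro strictly_concave_tangent[of "{0..1}"] G_deriv) (auto simp: G_def)
  then have "c * (g tc * tc) < c * G tc"
    using G0 c by (intro mult_strict_left_mono) auto
  then have "0 < b * tc"
    using fixpoint by (simp add: b_def algebra_simps)
  then have b: "0 < b" using tc by (simp add: zero_less_mult_iff)

  define \<mu> where "\<mu> t = (1 - a) * t - c * G t" for t
  define V where "V t = K_Omega a c F t t" for t
  have V_eq: "V t = (1 - c)\<^sup>2 * ((1 - a) * t) + c\<^sup>2 * (G t - (1 - a) * t) - (\<mu> t)\<^sup>2" for t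
    by (simp only: V_def K_Omega_diag aF \<mu>_def G_def)
  have "\<mu> tc = 0" using fixpoint by (simp add: \<mu>_def)
  have "0 < V tc"
  proof -
    have "0 < (1 - c)\<^sup>2 * ((1 - a) * tc)" using c a1 tc by simp
    moreover have "0 \<le> c\<^sup>2 * (a * F tc)"
      using a0 c F_ge[of tc] tc by simp
    ultimately show ?thesis
      unfolding V_eq aF[symmetric] using \<open>\<mu> tc = 0\<close> by simp
  qed
  have "\<exists>V'. (V has_real_derivative V') (at tc)"
  proof -
    have "(G has_real_derivative g tc) (at tc)" using tc by (intro G_deriv) auto
    then show ?thesis
      unfolding V_eq[abs_def] \<mu>_def by (intro exI) (auto intro!: derivative_eq_intros)
  qed
  then obtain V' where V': "(V has_real_derivative V') (at tc)" ..
  have "(\<lambda>t. G t - G tc - g tc * (t - tc)) \<in> O[at tc](\<lambda>t. (t - tc)\<^sup>2)"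
    using tc by (intro first_order_expansion[of tc 0 1] G_deriv g_Lipschitz_at_tc) auto
  then have "(\<lambda>t. - c * (G t - G tc - g tc * (t - tc))) \<in> O[at tc](\<lambda>t. (t - tc)\<^sup>2)"
    by (rule landau_o.big.cmult_in_iff[THEN iffD2, rotated]) (use c in auto)
  also have "(\<lambda>t. - c * (G t - G tc - g tc * (t - tc))) = (\<lambda>t. \<mu> t - b * (t - tc))"
    using fixpoint by (auto simp: \<mu>_def b_def algebra_simps fun_eq_iff)
  finally have "(\<lambda>t. \<mu> t / sqrt (V t) - b * (t - tc) / sqrt (V tc)) \<in> O[at tc](\<lambda>t. (t - tc)\<^sup>2)"
    using V' \<open>0 < V tc\<close> by (rule standardized_drift_expansion)
  then obtain C where C: "0 < C" "\<forall>\<^sub>F t in at tc.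
      norm (\<mu> t / sqrt (V t) - b * (t - tc) / sqrt (V tc)) \<le> C * norm ((t - tc)\<^sup>2)"
    by (rule landau_o.bigE)
  have "\<forall>\<^sub>F t in at tc. V tc / 2 < V t"
    using DERIV_isCont[OF V'] \<open>0 < V tc\<close> unfolding isCont_def
    by (intro order_tendstoD(1)[of V "V tc"]) auto
  moreover have "\<forall>\<^sub>F t in at tc. t \<in> {0<..<1}"
    using tc by (intro eventually_at_in_open') auto
  ultimately have "\<forall>\<^sub>F t in at tc. V tc / 2 < V t \<and> t \<in> {0<..<1} \<and>
      \<bar>\<mu> t / sqrt (V t) - b * (t - tc) / sqrt (V tc)\<bar> \<le> C * (t - tc)\<^sup>2"
    using C(2) by eventually_elim simp
  then have "\<forall>\<^sub>F t in nhds tc. V tc / 2 < V t \<and> t \<in> {0<..<1} \<and>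
      \<bar>\<mu> t / sqrt (V t) - b * (t - tc) / sqrt (V tc)\<bar> \<le> C * (t - tc)\<^sup>2"
    using \<open>0 < V tc\<close> \<open>\<mu> tc = 0\<close> tc unfolding eventually_nhds_conv_at by simp
  moreover

  define z where "z = upper_normal_quantile \<alpha>"
  \<comment> \<open>The threshold is tc - \<kappa> / sqrt m; the standardised drift there is - z / sqrt m to first
    order, so that sqrt m times it cancels against z.\<close>
  define \<kappa> where "\<kappa> = z * sqrt (V tc) / b"
  define t where "t m = t_cm a c F g tc \<alpha> m" for m
  have t_eq: "t m - tc = - \<kappa> / sqrt m" for m
    by (simp add: t_def t_cm_def \<kappa>_def z_def V_def b_def)
  have "t \<longlonglongrightarrow> tc"
  proof -
    have "(\<lambda>m. tc + - \<kappa> / sqrt (real m)) \<longlonglongrightarrow> tc" by real_asymp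
    moreover have "t = (\<lambda>m. tc + - \<kappa> / sqrt (real m))" using t_eq by (auto simp: fun_eq_iff algebra_simps)
    ultimately show ?thesis by simp
  qed
  ultimately have near: "\<forall>\<^sub>F m in sequentially. V tc / 2 < V (t m) \<and> t m \<in> {0<..<1} \<and>
      \<bar>\<mu> (t m) / sqrt (V (t m)) - b * (t m - tc) / sqrt (V tc)\<bar> \<le> C * (t m - tc)\<^sup>2"
    by (rule eventually_compose_filterlim)

  define p where "p m = measure (M m) {\<omega> \<in> space (M m). FDP m (P m) (H m) \<omega> (t m) \<le> c}" for m
  \<comment> \<open>The first constant is the normal approximation error, the second one the quadratic
    remainder C * (t m - tc) ^ 2 = C * \<kappa> ^ 2 / m of the drift, multiplied by sqrt m.\<close>
  have "\<forall>\<^sub>F m in sequentially. norm (p m - (1 - \<alpha>))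
      \<le> (50 / sqrt (V tc / 2) + C * \<kappa>\<^sup>2) * norm (1 / sqrt (real m))"
    using near eventually_gt_at_top[of 0]
  proof eventually_elim
    case (elim m)
    then have m: "0 < m" and Vm: "V tc / 2 < V (t m)" and tm: "t m \<in> {0..1}" by auto
    define s where "s = \<mu> (t m) / sqrt (V (t m))"
    interpret mixture_sample "M m" m a F "P m" "H m" by (rule sample)
    have "\<bar>p m - std_normal_cdf (- (sqrt m * s))\<bar> \<le> 50 / sqrt (m * V (t m))"
      unfolding p_def s_def V_def \<mu>_def G_def
      using m a0 a1 c tm Vm \<open>0 < V tc\<close> by (intro FDP_normal_approximation) (auto simp: V_def)
    also have "\<dots> \<le> 50 / (sqrt (V tc / 2) * sqrt m)"
      using Vm m \<open>0 < V tc\<close> by (auto simp: real_sqrt_mult mult.commute intro!: divide_left_mono mult_mono)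
    finally have approx: "\<bar>p m - std_normal_cdf (- (sqrt m * s))\<bar> \<le> 50 / sqrt (V tc / 2) * (1 / sqrt m)"
      by simp
    have "b * (t m - tc) / sqrt (V tc) = - z / sqrt m"
      using b \<open>0 < V tc\<close> by (simp add: t_eq \<kappa>_def)
    moreover have "(t m - tc)\<^sup>2 = \<kappa>\<^sup>2 / m"
      by (simp add: t_eq power_divide)
    ultimately have "\<bar>s + z / sqrt m\<bar> \<le> C * (\<kappa>\<^sup>2 / m)"
      using elim by (simp add: s_def)
    then have "sqrt m * \<bar>s + z / sqrt m\<bar> \<le> sqrt m * (C * (\<kappa>\<^sup>2 / m))"
      by (intro mult_left_mono) auto
    also have "sqrt m * (C * (\<kappa>\<^sup>2 / m)) = C * \<kappa>\<^sup>2 * (sqrt m / m)" by simp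
    also have "sqrt m / m = 1 / sqrt m" using m by (simp add: divide_simps)
    also have "sqrt m * \<bar>s + z / sqrt m\<bar> = \<bar>- (sqrt m * s) - z\<bar>"
    proof -
      have "sqrt m * (s + z / sqrt m) = - (- (sqrt m * s) - z)"
        using m by (simp add: field_simps)
      then show ?thesis using m by (metis abs_minus_cancel abs_mult abs_of_nonneg of_nat_0_le_iff real_sqrt_ge_zero)
    qed
    finally have "\<bar>std_normal_cdf (- (sqrt m * s)) - std_normal_cdf z\<bar> \<le> C * \<kappa>\<^sup>2 * (1 / sqrt m)"
      using std_normal_cdf_lipschitz order_trans by blast
    moreover have "std_normal_cdf z = 1 - \<alpha>"
      unfolding z_def by (rule std_normal_cdf_upper_normal_quantile[OF \<alpha>])
    ultimately have "\<bar>p m - (1 - \<alpha>)\<bar> \<le> 50 / sqrt (V tc / 2) * (1 / sqrt m) + C * \<kappa>\<^sup>2 * (1 / sqrt m)"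
      using approx by linarith
    then show ?case using m by (simp only: real_norm_def distrib_right) simp
  qed
  then show ?thesis
    unfolding p_def t_def by (rule bigoI)
qed

end
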